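(* Let $\nu=n+\frac12$ with $n\in\mathbb{N}$, and let $z_{\nu,1},\dots,z_{\nu,n}$ be the zeros of the modified Bessel function of the second kind $K_\nu$ (equivalently, the $n$ zeros in $\mathbb{C}$ of the polynomial $H_n$ defined in the context). Then for every $j\in\{1,\dots,n\}$ the following three identities hold: $$\sum_{k=1,\ k\neq j}^n\frac{1}{z_{\nu,k}-z_{\nu,j}}=\frac{1-2z_{\nu,j}-2\nu}{2z_{\nu,j}},$$ $$\sum_{k=1,\ k\neq j}^n\frac{1}{z_{\nu,k}^2-z_{\nu,j}^2}=\frac{1-z_{\nu,j}-\nu}{2z_{\nu,j}^2}-\frac{1}{2z_{\nu,j}}\sum_{k=1}^n\frac{1}{z_{\nu,k}+z_{\nu,j}},$$ $$\sum_{k=1,\ k\neq j}^n\frac{1}{z_{\nu,k}^4-z_{\nu,j}^4}=\frac{2-\nu-z_{\nu,j}}{4z_{\nu,j}^4}-\frac{1}{4z_{\nu,j}^3}\sum_{k=1}^n\left(\frac{1}{z_{\nu,j}+z_{\nu,k}}+\frac{2z_{\nu,j}}{z_{\nu,j}^2+z_{\nu,k}^2}\right).$$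
   Context: $K_\nu$ is the modified Bessel function of the second kind (Macdonald function). For $\nu=n+\frac12$, $n\in\mathbb{N}$, it is given by $$K_\nu(z)=\sqrt{\frac{\pi}{2z}}\,\frac{e^{-z}}{z^n}\,H_n(z),\qquad H_n(z)=\sum_{k=0}^n\frac{\Gamma(2n-k+1)\,z^k}{\Gamma(n-k+1)\,\Gamma(k+1)\,2^{n-k}},$$ where $H_n$ is a monic polynomial of degree $n$. It is known that for $n\ge1$, $K_{n+\frac12}$ has exactly $n$ zeros, each of multiplicity one, all lying in $\{z\in\mathbb{C}:\operatorname{Re} z<0\}$, with non-real zeros occurring in complex conjugate pairs; these are exactly the zeros of $H_n$, so that $H_n(z)=\prod_{j=1}^n(z-z_{\nu,j})$. *)

theory Defs
  imports
    "HOL-Analysis.Analysis"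
    "HOL-Computational_Algebra.Polynomial"
    "HOL-Computational_Algebra.Fundamental_Theorem_Algebra"
begin

(* Modified Bessel functions of complex order and argument z \<noteq> 0, on the principal branch of
   powr; the values at z = 0 are meaningless. *)

definition bessel_I :: "complex \<Rightarrow> complex \<Rightarrow> complex" where
  "bessel_I \<nu> z = (z / 2) powr \<nu> *
     (\<Sum>m. rGamma (\<nu> + of_nat m + 1) / fact m * (z / 2) ^ (2 * m))"

definition bessel_K :: "complex \<Rightarrow> complex \<Rightarrow> complex" where
  "bessel_K \<nu> z =
     (let K = (\<lambda>\<mu>. of_real pi / 2 * (bessel_I (- \<mu>) z - bessel_I \<mu> z) / sin (\<mu> * of_real pi))
      in if \<nu> \<in> \<int> then Lim (at \<nu>) K else K \<nu>)"

(* z = 0 is a singularity, not a zero. For \<nu> = n + 1/2, z powr \<nu> * bessel_K \<nu> z extends to an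
   entire function, so the set of zeros does not depend on the branch of powr, and the zeros on the
   negative real axis, where powr has its cut, are included. *)

definition bessel_K_zeros :: "complex \<Rightarrow> complex set" where
  "bessel_K_zeros \<nu> = {z. z \<noteq> 0 \<and> bessel_K \<nu> z = 0}"

definition H_poly :: "nat \<Rightarrow> complex poly" where
  "H_poly n = (\<Sum>k=0..n. monom
     (Gamma (of_nat (2 * n - k + 1)) /
      (Gamma (of_nat (n - k + 1)) * Gamma (of_nat (k + 1)) * 2 ^ (n - k))) k)"


lemma coeff_H_poly:
  "coeff (H_poly n) k =
     (if k \<le> n then fact (2 * n - k) / (fact (n - k) * fact k * 2 ^ (n - k)) else 0)"
proof -
  have *: "Gamma (of_nat (m + 1) :: complex) = fact m" for m
    using Gamma_fact[of m, where 'a = complex] by (simp add: add.commute)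
  show ?thesis
    unfolding H_poly_def * coeff_sum coeff_monom by (simp add: sum.delta)
qed

lemma H_poly_rec:
  "H_poly (Suc (Suc n)) = smult (of_nat (2 * n + 3)) (H_poly (Suc n)) + monom 1 2 * H_poly n"
proof (rule poly_eqI)
  fix k
  consider "k > n + 2" | "k = n + 2" | "k \<le> n + 1" by linarith
  thus "coeff (H_poly (Suc (Suc n))) k =
        coeff (smult (of_nat (2 * n + 3)) (H_poly (Suc n)) + monom 1 2 * H_poly n) k"
  proof cases
    case 3
    define a where "a = n + 1 - k"
    define N where "N = 2 * n + 2 - k"
    have e: "2 * Suc (Suc n) - k = Suc (Suc N)" "Suc (Suc n) - k = Suc a"
            "2 * Suc n - k = N" "Suc n - k = a"
      using 3 by (auto simp: a_def N_def)
    have na: "of_nat N = (2 * of_nat n + 2 - of_nat k :: complex)"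
             "of_nat a = (of_nat n + 1 - of_nat k :: complex)"
      using 3 by (auto simp: a_def N_def of_nat_diff)
    have key: "(of_nat N + 1) * (of_nat N + 2) =
       (2 * of_nat n + 3) * (2 * (of_nat a + 1)) + of_nat k * (of_nat k - 1 :: complex)"
      unfolding na by (simp add: algebra_simps)
    have c: "coeff (monom 1 2 * H_poly n) k =
        of_nat k * (of_nat k - 1) * (fact N / (fact (Suc a) * fact k * 2 ^ Suc a))"
    proof (cases "k < 2")
      case True
      hence "k = 0 \<or> k = 1" by auto
      thus ?thesis using True by (auto simp: coeff_monom_mult)
    next
      case False
      then obtain l where l: "k = Suc (Suc l)" by (metis less_2_cases_iff not0_implies_Suc One_nat_def)
      have "2 * n - l = N" "n - l = Suc a" "l \<le> n"
        using 3 l by (auto simp: N_def a_def)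
      thus ?thesis unfolding l
        by (simp add: coeff_monom_mult coeff_H_poly divide_simps del: of_nat_Suc power_Suc)
           (simp add: algebra_simps)
    qed
    have nz: "1 + of_nat a \<noteq> (0 :: complex)"
      by (metis of_nat_Suc of_nat_eq_0_iff Suc_neq_Zero add.commute)
    define F where "F = (fact N / (fact (Suc a) * fact k * 2 ^ Suc a) :: complex)"
    have "coeff (H_poly (Suc (Suc n))) k = (of_nat N + 1) * (of_nat N + 2) * F"
      using 3 unfolding coeff_H_poly e F_def
      by (simp add: divide_simps del: power_Suc of_nat_Suc fact_Suc) (simp add: algebra_simps)
    moreover have "coeff (H_poly (Suc n)) k = 2 * (of_nat a + 1) * F"
      using 3 nz unfolding coeff_H_poly e F_def by (simp add: divide_simps)
    moreover have "coeff (monom 1 2 * H_poly n) k = of_nat k * (of_nat k - 1) * F"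
      using c by (simp add: F_def)
    ultimately show ?thesis
      unfolding coeff_add coeff_smult by (simp only: key) (simp add: algebra_simps)
  next
    case 2
    have "(of_nat (fact (Suc (Suc n))) :: complex) \<noteq> 0" by (simp del: fact_Suc)
    thus ?thesis using 2 by (simp add: coeff_H_poly coeff_monom_mult del: fact_Suc)
  qed (auto simp: coeff_H_poly coeff_monom_mult)
qed

lemma degree_H_poly: "degree (H_poly n) = n" "lead_coeff (H_poly n) = 1"
proof -
  show "degree (H_poly n) = n"
  proof (rule antisym)
    show "degree (H_poly n) \<le> n" by (rule degree_le) (simp add: coeff_H_poly)
    show "n \<le> degree (H_poly n)" by (rule le_degree) (simp add: coeff_H_poly)
  qed
  thus "lead_coeff (H_poly n) = 1" by (simp add: coeff_H_poly)
qed

lemma poly_H_poly_0: "poly (H_poly n) 0 \<noteq> 0"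
  by (simp add: poly_0_coeff_0 coeff_H_poly)

lemma pderiv_H_poly: "pderiv (H_poly (Suc n)) = H_poly (Suc n) - monom 1 1 * H_poly n"
proof (rule poly_eqI)
  fix k
  consider "k > n + 1" | "k = n + 1" | "k \<le> n" by linarith
  thus "coeff (pderiv (H_poly (Suc n))) k = coeff (H_poly (Suc n) - monom 1 1 * H_poly n) k"
  proof cases
    case 3
    define a where "a = n - k"
    have e: "2 * Suc n - Suc k = n + 1 + a" "Suc n - Suc k = a" "2 * Suc n - k = Suc (n + 1 + a)"
            "Suc n - k = Suc a"
      using 3 by (auto simp: a_def)
    define F where "F = (fact (n + 1 + a) / (fact (Suc a) * fact k * 2 ^ Suc a) :: complex)"
    have nz: "of_nat (Suc a) \<noteq> (0 :: complex)" "of_nat (Suc k) \<noteq> (0 :: complex)"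
      by (simp_all del: of_nat_Suc)
    have c1: "coeff (pderiv (H_poly (Suc n))) k = 2 * of_nat (Suc a) * F"
      using 3 nz unfolding coeff_pderiv coeff_H_poly e F_def
      by (simp add: divide_simps del: of_nat_Suc)
    have c2: "coeff (H_poly (Suc n)) k = of_nat (Suc (n + 1 + a)) * F"
      using 3 unfolding coeff_H_poly e F_def
      by (simp add: divide_simps del: power_Suc of_nat_Suc) 
    have c3: "coeff (monom 1 1 * H_poly n) k = of_nat k * F"
    proof (cases k)
      case 0
      thus ?thesis by (simp add: coeff_monom_mult)
    next
      case (Suc l)
      have e': "2 * n - l = n + 1 + a" "n - l = Suc a" "l \<le> n"
        using 3 Suc by (auto simp: a_def)
      show ?thesis unfolding Suc F_def using e'
        by (simp add: coeff_monom_mult coeff_H_poly divide_simps del: of_nat_Suc power_Suc)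
    qed
    have "of_nat n = (of_nat a + of_nat k :: complex)"
      using 3 by (simp add: a_def of_nat_diff)
    thus ?thesis
      unfolding coeff_diff c1 c2 c3 by (simp add: algebra_simps)
  next
    case 2
    have "1 + of_nat n \<noteq> (0 :: complex)" by (metis of_nat_Suc of_nat_eq_0_iff Suc_neq_Zero)
    thus ?thesis using 2 by (auto simp: coeff_pderiv coeff_H_poly coeff_monom_mult)
  qed (auto simp: coeff_pderiv coeff_H_poly coeff_monom_mult)
qed

lemma rsquarefree_H_poly: "rsquarefree (H_poly n)"
proof -
  have *: "\<not> (poly (H_poly n) w = 0 \<and> poly (H_poly (Suc n)) w = 0)" if "w \<noteq> 0" for n w
  proof (induction n)
    case 0
    have "poly (H_poly 0) w = 1" by (simp add: H_poly_def poly_monom)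
    thus ?case by simp
  next
    case (Suc n)
    thus ?case using that by (auto simp: H_poly_rec poly_monom)
  qed
  show ?thesis unfolding rsquarefree_roots
  proof (intro allI notI, elim conjE)
    fix w assume w: "poly (H_poly n) w = 0" "poly (pderiv (H_poly n)) w = 0"
    have w0: "w \<noteq> 0" using w poly_H_poly_0 by metis
    show False
    proof (cases n)
      case 0
      thus ?thesis using w by (simp add: H_poly_def poly_monom)
    next
      case (Suc m)
      thus ?thesis using w w0 *[of w m] by (auto simp: pderiv_H_poly poly_monom)
    qed
  qed
qed

lemma card_H_poly_roots: "card {w. poly (H_poly n) w = 0} = n"
proof -
  have fin: "finite {w. poly (H_poly n) w = 0}"
    using poly_roots_finite[of "H_poly n"] poly_H_poly_0[of n] by fastforce
  have "H_poly n = (\<Prod>w | poly (H_poly n) w = 0. [:- w, 1:])"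
    using complex_poly_decompose_rsquarefree[OF rsquarefree_H_poly[of n]] degree_H_poly[of n]
    by simp
  hence "n = degree (\<Prod>w | poly (H_poly n) w = 0. [:- w, 1:])"
    using degree_H_poly(1) by metis
  also have "\<dots> = card {w. poly (H_poly n) w = 0}"
    by (subst degree_prod_eq_sum_degree) auto
  finally show ?thesis ..
qed


lemma bessel_I_summable:
  "summable (\<lambda>m. rGamma (\<nu> + of_nat m + 1) / fact m * (x :: complex) ^ (2 * m))"
proof -
  define a where "a = (\<lambda>m. rGamma (\<nu> + of_nat m + 1) / fact m * x ^ (2 * m))"
  define N where "N = nat \<lceil>2 * norm x ^ 2 + norm \<nu>\<rceil>"
  have rec: "(\<nu> + of_nat m + 1) * of_nat (Suc m) * a (Suc m) = x ^ 2 * a m" for m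
  proof -
    have "(\<nu> + of_nat m + 1) * rGamma (\<nu> + of_nat (Suc m) + 1) = rGamma (\<nu> + of_nat m + 1)"
      using rGamma_plus1[of "\<nu> + of_nat m + 1"] by (simp add: add_ac)
    moreover have "of_nat (Suc m) * (y / fact (Suc m)) = (y / fact m :: complex)" for y
      by (simp del: of_nat_Suc)
    moreover have "x ^ (2 * Suc m) = x ^ 2 * x ^ (2 * m)"
      by (simp add: power_add[symmetric])
    moreover have "(\<nu> + of_nat m + 1) * of_nat (Suc m) * a (Suc m) = of_nat (Suc m) *
        (((\<nu> + of_nat m + 1) * rGamma (\<nu> + of_nat (Suc m) + 1) * x ^ (2 * Suc m)) / fact (Suc m))"
      unfolding a_def by (simp del: of_nat_Suc fact_Suc power_Suc mult_Suc_right)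
    ultimately show ?thesis
      unfolding a_def by (simp only:) (simp add: mult_ac)
  qed
  have "norm (a (Suc m)) \<le> 1 / 2 * norm (a m)" if m: "m \<ge> N" for m
  proof -
    have m': "real m \<ge> 2 * norm x ^ 2 + norm \<nu>"
      using m unfolding N_def by linarith
    have "norm (of_nat m + 1 + \<nu>) \<ge> norm (of_nat m + 1 :: complex) - norm \<nu>"
      by (rule norm_diff_ineq)
    moreover have "norm (of_nat m + 1 :: complex) = real m + 1"
      by (metis norm_of_nat of_nat_Suc add.commute)
    moreover have "of_nat m + 1 + \<nu> = \<nu> + of_nat m + 1" by simp
    ultimately have "norm (\<nu> + of_nat m + 1) \<ge> real m + 1 - norm \<nu>" by metis
    hence n1: "norm (\<nu> + of_nat m + 1) \<ge> 1"
      using m' zero_le_power2[of "norm x"] by linarith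
    have n2: "real (Suc m) \<ge> 2 * norm x ^ 2"
      using m' norm_ge_zero[of \<nu>] by linarith
    have "2 * norm x ^ 2 * norm (a (Suc m)) \<le> real (Suc m) * norm (a (Suc m))"
      using n2 by (intro mult_right_mono) auto
    also have "\<dots> \<le> norm (\<nu> + of_nat m + 1) * (real (Suc m) * norm (a (Suc m)))"
      using mult_right_mono[OF n1, of "real (Suc m) * norm (a (Suc m))"] by simp
    also have "\<dots> = norm (x ^ 2 * a m)"
      unfolding rec[symmetric] norm_mult norm_of_nat by simp
    finally have le: "norm x ^ 2 * (2 * norm (a (Suc m))) \<le> norm x ^ 2 * norm (a m)"
      by (simp add: norm_mult norm_power mult_ac)
    show ?thesis
    proof (cases "x = 0")
      case True
      thus ?thesis by (simp add: a_def)
    next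
      case False
      hence "norm x ^ 2 > 0" by simp
      thus ?thesis using le by (simp add: mult_le_cancel_left_pos)
    qed
  qed
  hence "summable a" by (intro summable_ratio_test[of "1/2" N]) auto
  thus ?thesis by (simp add: a_def)
qed

lemma bessel_I_rec:
  assumes "z \<noteq> 0"
  shows "bessel_I (\<nu> - 1) z - bessel_I (\<nu> + 1) z = 2 * \<nu> / z * bessel_I \<nu> z"
proof -
  define x where "x = z / 2"
  have x: "x \<noteq> 0" using assms by (simp add: x_def)
  define S where "S = (\<lambda>\<nu> m. rGamma (\<nu> + of_nat m + 1) / fact m * x ^ (2 * m))"
  have summ: "summable (S \<nu>)" for \<nu>
    unfolding S_def by (rule bessel_I_summable)
  have shift: "(\<lambda>m. if m = 0 then 0 else x ^ 2 * S (\<nu> + 1) (m - 1)) sums (x ^ 2 * suminf (S (\<nu> + 1)))"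
    using sums_mult[OF summable_sums[OF summ], of "x ^ 2" "\<nu> + 1"]
    by (subst sums_Suc_iff[symmetric, where f = "\<lambda>m. if m = 0 then 0 else _ m", simplified]) auto
  have eq: "S (\<nu> - 1) m - (if m = 0 then 0 else x ^ 2 * S (\<nu> + 1) (m - 1)) = \<nu> * S \<nu> m" for m
  proof (cases m)
    case 0
    thus ?thesis using rGamma_plus1[of \<nu>] by (simp add: S_def)
  next
    case (Suc l)
    define g where "g = rGamma (\<nu> + of_nat m + 1)"
    define f where "f = (fact l :: complex)"
    have nz: "f \<noteq> 0" "of_nat m \<noteq> (0 :: complex)" by (simp_all add: f_def Suc del: of_nat_Suc)
    have "rGamma (\<nu> - 1 + of_nat m + 1) = (\<nu> + of_nat m) * g"
      unfolding g_def by (simp add: rGamma_plus1)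
    moreover have "rGamma (\<nu> + 1 + of_nat l + 1) = g" by (simp add: Suc g_def add_ac)
    moreover have "fact m = of_nat m * f" by (simp add: Suc f_def)
    moreover have "x ^ (2 * m) = x ^ 2 * x ^ (2 * l)" by (simp add: Suc power_add[symmetric])
    moreover have "m \<noteq> 0" "m - 1 = l" by (simp_all add: Suc)
    ultimately have e: "S (\<nu> - 1) m = (\<nu> + of_nat m) * g / (of_nat m * f) * (x ^ 2 * x ^ (2 * l))"
      "S \<nu> m = g / (of_nat m * f) * (x ^ 2 * x ^ (2 * l))" "S (\<nu> + 1) l = g / f * x ^ (2 * l)"
      by (simp_all add: S_def g_def f_def)
    show ?thesis
      using nz \<open>m \<noteq> 0\<close> \<open>m - 1 = l\<close> unfolding e by (simp add: e) (simp add: field_simps)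
  qed
  have "suminf (S (\<nu> - 1)) - x ^ 2 * suminf (S (\<nu> + 1)) = \<nu> * suminf (S \<nu>)"
    using sums_unique2[OF sums_diff[OF summable_sums[OF summ] shift, of "\<nu> - 1"]]
          sums_mult[OF summable_sums[OF summ], of \<nu> \<nu>]
    unfolding eq by blast
  moreover have "x powr (\<nu> + 1) = x powr (\<nu> - 1) * x ^ 2" "x powr \<nu> = x powr (\<nu> - 1) * x"
    using x powr_add[of x "\<nu> - 1" 2] powr_add[of x "\<nu> - 1" 1]
    by (simp_all add: power2_eq_square add.commute)
  ultimately have "x powr (\<nu> - 1) * suminf (S (\<nu> - 1)) - x powr (\<nu> + 1) * suminf (S (\<nu> + 1))
      = x powr (\<nu> - 1) * (\<nu> * suminf (S \<nu>))"
    by (metis (no_types, lifting) mult.assoc right_diff_distrib)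
  also have "\<dots> = 2 * \<nu> / z * (x powr \<nu> * suminf (S \<nu>))"
    unfolding \<open>x powr \<nu> = _\<close> using assms by (simp add: x_def field_simps)
  finally show ?thesis
    by (simp only: bessel_I_def S_def x_def)
qed

lemma bessel_K_rec:
  assumes "z \<noteq> 0" "\<nu> \<notin> \<int>"
  shows "bessel_K (\<nu> + 1) z = bessel_K (\<nu> - 1) z + 2 * \<nu> / z * bessel_K \<nu> z"
proof -
  define c where "c = of_real pi / (2 * sin (\<nu> * of_real pi))"
  have n: "\<nu> + 1 \<notin> \<int>" "\<nu> - 1 \<notin> \<int>" using assms(2) using Ints_diff[of "\<nu> + 1" 1] Ints_add[of "\<nu> - 1" 1] by auto
  have s: "sin ((\<nu> + 1) * of_real pi) = - sin (\<nu> * of_real pi)"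
          "sin ((\<nu> - 1) * of_real pi) = - sin (\<nu> * of_real pi)"
    by (simp_all add: ring_distribs sin_add sin_diff)
  have K: "bessel_K (\<nu> + 1) z = - c * (bessel_I (- \<nu> - 1) z - bessel_I (\<nu> + 1) z)"
          "bessel_K (\<nu> - 1) z = - c * (bessel_I (- \<nu> + 1) z - bessel_I (\<nu> - 1) z)"
          "bessel_K \<nu> z = c * (bessel_I (- \<nu>) z - bessel_I \<nu> z)"
    using n assms(2) unfolding bessel_K_def Let_def s by (simp_all add: c_def)
  have "bessel_K (\<nu> + 1) z - bessel_K (\<nu> - 1) z =
    - c * ((bessel_I (- \<nu> - 1) z - bessel_I (- \<nu> + 1) z) + (bessel_I (\<nu> - 1) z - bessel_I (\<nu> + 1) z))"
    unfolding K by (simp add: algebra_simps)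
  also have "\<dots> = 2 * \<nu> / z * bessel_K \<nu> z"
    unfolding bessel_I_rec[OF assms(1)] K by (simp add: algebra_simps)
  finally show ?thesis by (simp add: algebra_simps)
qed

lemma rGamma_half: "rGamma (of_nat m + 1 / 2) / fact m = 4 ^ m / (of_real (sqrt pi) * fact (2 * m) :: complex)"
proof (induction m)
  case 0
  show ?case by (simp add: rGamma_inverse_Gamma Gamma_one_half_complex field_simps)
next
  case (Suc m)
  define g where "g = rGamma (of_nat (Suc m) + 1 / 2 :: complex)"
  have "of_nat (2 * m + 1) \<noteq> (0 :: complex)" "of_nat (m + 1) \<noteq> (0 :: complex)"
    by (simp_all del: of_nat_Suc of_nat_add)
  hence nz: "2 * of_nat m + 1 \<noteq> (0 :: complex)" "of_nat m + 1 \<noteq> (0 :: complex)"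
    by (simp_all add: add.commute)
  have "rGamma (of_nat m + 1 / 2 :: complex) = (of_nat m + 1 / 2) * g"
    using rGamma_plus1[of "of_nat m + 1 / 2 :: complex"] by (simp add: g_def add_ac)
  hence g: "g = rGamma (of_nat m + 1 / 2 :: complex) * 2 / (2 * of_nat m + 1)"
    using nz by (simp add: field_simps)
  have "g / fact (Suc m) = (rGamma (of_nat m + 1 / 2) / fact m) * (2 / ((2 * of_nat m + 1) * (of_nat m + 1)))"
    unfolding g by (simp add: field_simps)
  also have "\<dots> = 4 ^ m / (of_real (sqrt pi) * fact (2 * m)) * (2 / ((2 * of_nat m + 1) * (of_nat m + 1)))"
    unfolding Suc ..
  also have "2 / ((2 * of_nat m + 1) * (of_nat m + 1)) =
      (4 :: complex) / ((2 * of_nat m + 1) * (2 * of_nat m + 2))"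
  proof -
    have e: "2 * of_nat m + 2 = 2 * (of_nat m + 1 :: complex)" by simp
    have "4 / (y * (2 * w)) = 2 / (y * w)" for y w :: complex
      by (cases "y = 0"; cases "w = 0") (simp_all add: field_simps)
    thus ?thesis unfolding e by (rule sym)
  qed
  also have "4 ^ m / (of_real (sqrt pi) * fact (2 * m)) * \<dots> =
      4 ^ Suc m / (of_real (sqrt pi) * fact (2 * Suc m) :: complex)"
  proof -
    have "(fact (2 * Suc m) :: complex) = (2 * of_nat m + 2) * ((2 * of_nat m + 1) * fact (2 * m))"
      by (simp add: algebra_simps)
    thus ?thesis by (simp add: mult_ac)
  qed
  finally show ?case by (simp only: g_def)
qed

lemma bessel_I_half:
  assumes "z \<noteq> 0"
  shows "bessel_I (- (1 / 2)) z = (z / 2) powr (- (1 / 2)) * cosh z / of_real (sqrt pi)"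
    and "bessel_I (1 / 2) z = (z / 2) powr (- (1 / 2)) * sinh z / of_real (sqrt pi)"
proof -
  have pw: "4 ^ m * (z / 2) ^ (2 * m) = z ^ (2 * m)" for m
  proof -
    have "(4 :: complex) ^ m = 2 ^ (2 * m)" by (simp add: power_mult)
    thus ?thesis by (simp add: power_divide)
  qed
  have ev: "(m :: nat) \<in> range (\<lambda>m. 2 * m)" if "even m" for m
    using that by (auto elim!: evenE)
  have od: "(m :: nat) \<in> range (\<lambda>m. 2 * m + 1)" if "odd m" for m
    using that by (auto elim!: oddE)
  have "(\<lambda>m. if even (2 * m) then z ^ (2 * m) /\<^sub>R fact (2 * m) else 0) sums cosh z"
    by (subst sums_mono_reindex[where g = "\<lambda>m. 2 * m" and f = "\<lambda>n. if even n then z ^ n /\<^sub>R fact n else 0"])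
       (use ev cosh_converges[of z] in \<open>auto simp: strict_mono_def\<close>)
  hence c: "(\<lambda>m. z ^ (2 * m) / fact (2 * m)) sums cosh z"
    by (simp add: scaleR_conv_of_real divide_inverse mult.commute)
  have "(\<lambda>m. if even (2 * m + 1) then 0 else z ^ (2 * m + 1) /\<^sub>R fact (2 * m + 1)) sums sinh z"
    by (subst sums_mono_reindex[where g = "\<lambda>m. 2 * m + 1" and f = "\<lambda>n. if even n then 0 else z ^ n /\<^sub>R fact n"])
       (use od sinh_converges[of z] in \<open>auto simp: strict_mono_def\<close>)
  hence s: "(\<lambda>m. z ^ (2 * m + 1) / fact (2 * m + 1)) sums sinh z"
    by (simp add: scaleR_conv_of_real divide_inverse mult.commute del: fact_Suc)
  have t1: "rGamma (- (1 / 2) + of_nat m + 1) / fact m * (z / 2) ^ (2 * m) =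
      1 / of_real (sqrt pi) * (z ^ (2 * m) / fact (2 * m))" for m
  proof -
    have "- (1 / 2) + of_nat m + 1 = of_nat m + (1 / 2 :: complex)" by simp
    hence "rGamma (- (1 / 2) + of_nat m + 1) / fact m = 4 ^ m / (of_real (sqrt pi) * fact (2 * m) :: complex)"
      by (simp only: rGamma_half)
    thus ?thesis by (simp add: pw[symmetric])
  qed
  show "bessel_I (- (1 / 2)) z = (z / 2) powr (- (1 / 2)) * cosh z / of_real (sqrt pi)"
    unfolding bessel_I_def t1 sums_unique[OF sums_mult[OF c], symmetric] by simp
  have t2: "rGamma (1 / 2 + of_nat m + 1) / fact m * (z / 2) ^ (2 * m) =
      2 / (z * of_real (sqrt pi)) * (z ^ (2 * m + 1) / fact (2 * m + 1))" for m
  proof -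
    have "of_nat (2 * m + 1) \<noteq> (0 :: complex)" by (simp del: of_nat_Suc of_nat_add)
    hence nz: "2 * of_nat m + 1 \<noteq> (0 :: complex)" by (simp add: add.commute)
    have "rGamma (of_nat m + 1 / 2 :: complex) = (of_nat m + 1 / 2) * rGamma (1 / 2 + of_nat m + 1)"
      using rGamma_plus1[of "of_nat m + 1 / 2 :: complex"] by (simp add: add_ac)
    hence "rGamma (1 / 2 + of_nat m + 1) = rGamma (of_nat m + 1 / 2 :: complex) * 2 / (2 * of_nat m + 1)"
      using nz by (simp add: field_simps)
    hence "rGamma (1 / 2 + of_nat m + 1) / fact m =
        rGamma (of_nat m + 1 / 2 :: complex) / fact m * (2 / (2 * of_nat m + 1))"
      by simp
    hence "rGamma (1 / 2 + of_nat m + 1) / fact m * (z / 2) ^ (2 * m) =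
        4 ^ m * (z / 2) ^ (2 * m) / (of_real (sqrt pi) * fact (2 * m)) * (2 / (2 * of_nat m + 1))"
      unfolding rGamma_half by simp
    also have "\<dots> = 2 / (z * of_real (sqrt pi)) * (z * z ^ (2 * m) / ((2 * of_nat m + 1) * fact (2 * m)))"
      unfolding pw using assms by (simp add: mult_ac)
    also have "z * z ^ (2 * m) = z ^ (2 * m + 1)" by simp
    also have "(2 * of_nat m + 1) * fact (2 * m) = (fact (2 * m + 1) :: complex)"
      by (simp add: algebra_simps)
    finally show ?thesis .
  qed
  have p: "(z / 2) powr (1 / 2) = (z / 2) powr (- (1 / 2)) * (z / 2)"
    using powr_add[of "z / 2" "- (1 / 2)" 1] assms by simp
  show "bessel_I (1 / 2) z = (z / 2) powr (- (1 / 2)) * sinh z / of_real (sqrt pi)"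
    unfolding bessel_I_def t2 sums_unique[OF sums_mult[OF s], symmetric] p using assms by simp
qed

lemma half_not_Ints: "of_nat n + 1 / 2 \<notin> (\<int> :: complex set)"
proof
  assume "of_nat n + 1 / 2 \<in> (\<int> :: complex set)"
  hence "(of_nat n + 1 / 2) - of_nat n \<in> (\<int> :: complex set)" by (intro Ints_diff) auto
  thus False using fraction_not_in_Ints[of 2 1, where 'a = complex] by simp
qed

lemma bessel_K_half_aux:
  assumes "z \<noteq> 0"
  shows "bessel_K (of_nat n + 1 / 2) z =
           of_real (sqrt pi) / 2 * (z / 2) powr (- (1 / 2)) * exp (- z) / z ^ n * poly (H_poly n) z"
proof (induction n rule: less_induct)
  define C where "C = of_real (sqrt pi) / 2 * (z / 2) powr (- (1 / 2)) * exp (- z)"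
  have pi: "complex_of_real pi = of_real (sqrt pi) * of_real (sqrt pi)"
    by (simp flip: of_real_mult)
  have half: "(1 / 2 :: complex) \<notin> \<int>" "(- (1 / 2) :: complex) \<notin> \<int>"
    using half_not_Ints[of 0] Ints_minus[of "- (1 / 2) :: complex"] by auto
  have sin: "sin (complex_of_real pi / 2) = 1"
    using sin_of_real[of "pi / 2", where 'a = complex] by simp
  have "bessel_I (- (1 / 2)) z - bessel_I (1 / 2) z = (z / 2) powr (- (1 / 2)) * exp (- z) / of_real (sqrt pi)"
    unfolding bessel_I_half[OF assms] by (simp add: cosh_minus_sinh[symmetric] algebra_simps diff_divide_distrib)
  hence K0: "bessel_K (1 / 2) z = C"
    using half sin by (simp add: bessel_K_def Let_def C_def pi)
  have "bessel_K (- (1 / 2)) z = bessel_K (1 / 2) z"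
    using half sin by (simp add: bessel_K_def Let_def algebra_simps)
  hence K1: "bessel_K (1 / 2 + 1) z = C + C / z"
    using bessel_K_rec[OF assms half(1)] K0 by simp
  have H01: "poly (H_poly 0) z = 1" "poly (H_poly (Suc 0)) z = z + 1"
    using Gamma_fact[of 1, where 'a = complex] Gamma_fact[of 2, where 'a = complex]
    by (simp_all add: H_poly_def poly_monom)
  fix n
  assume IH: "bessel_K (of_nat m + 1 / 2) z =
     of_real (sqrt pi) / 2 * (z / 2) powr (- (1 / 2)) * exp (- z) / z ^ m * poly (H_poly m) z"
    if "m < n" for m
  consider "n = 0" | "n = Suc 0" | m where "n = Suc (Suc m)" by (metis not0_implies_Suc)
  thus "bessel_K (of_nat n + 1 / 2) z =
     of_real (sqrt pi) / 2 * (z / 2) powr (- (1 / 2)) * exp (- z) / z ^ n * poly (H_poly n) z"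
  proof cases
    case 1
    thus ?thesis using K0 by (simp add: H01 C_def)
  next
    case 2
    have "bessel_K (of_nat n + 1 / 2) z = C + C / z" using K1 by (simp add: 2 add.commute)
    also have "\<dots> = C / z ^ n * poly (H_poly n) z" using assms by (simp add: 2 H01 field_simps)
    finally show ?thesis by (simp add: C_def)
  next
    case 3
    let ?\<nu> = "of_nat (Suc m) + 1 / 2 :: complex"
    have e: "of_nat n + 1 / 2 = ?\<nu> + 1" "?\<nu> - 1 = of_nat m + 1 / 2"
      "2 * ?\<nu> = of_nat (2 * m + 3)" by (simp_all add: 3)
    have "bessel_K (of_nat n + 1 / 2) z =
      bessel_K (of_nat m + 1 / 2) z + of_nat (2 * m + 3) / z * bessel_K ?\<nu> z"
      using bessel_K_rec[OF assms half_not_Ints[of "Suc m"]] unfolding e .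
    also have "\<dots> = C / z ^ m * poly (H_poly m) z +
        of_nat (2 * m + 3) / z * (C / z ^ Suc m * poly (H_poly (Suc m)) z)"
      using IH[of m] IH[of "Suc m"] by (simp only: 3 C_def lessI less_SucI)
    also have "\<dots> = C / z ^ n * poly (H_poly n) z"
    proof -
      define p where "p = poly (H_poly m) z"
      define q where "q = poly (H_poly (Suc m)) z"
      define c where "c = (of_nat (2 * m + 3) :: complex)"
      have "poly (H_poly n) z = c * q + z ^ 2 * p"
        by (simp add: 3 H_poly_rec poly_monom p_def q_def c_def)
      thus ?thesis unfolding p_def[symmetric] q_def[symmetric] c_def[symmetric]
        using assms by (simp add: 3 divide_simps power2_eq_square) (simp add: algebra_simps)
    qed
    finally show ?thesis by (simp add: C_def)
  qed
qed

theorem bessel_K_half: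
  assumes "z \<notin> \<real>\<^sub>\<le>\<^sub>0"
  shows "bessel_K (of_nat n + 1 / 2) z =
           csqrt (of_real pi / (2 * z)) * exp (- z) / z ^ n * poly (H_poly n) z"
proof -
  have z: "z \<noteq> 0" using assms by auto
  have "z / 2 \<notin> \<real>\<^sub>\<le>\<^sub>0" using assms by (auto simp: complex_nonpos_Reals_iff)
  hence "Ln (inverse (z / 2)) = - Ln (z / 2)" by (rule Ln_inverse)
  moreover have "of_real pi / (2 * z) = of_real (pi / 4) * inverse (z / 2)"
    by (simp add: field_simps)
  ultimately have "Ln (of_real pi / (2 * z)) = of_real (ln (pi / 4)) - Ln (z / 2)"
    using Ln_times_of_real[of "pi / 4" "inverse (z / 2)"] Ln_of_real[of "pi / 4"] z by simp
  hence "csqrt (of_real pi / (2 * z)) = exp (of_real (ln (pi / 4) / 2) + - (1 / 2) * Ln (z / 2))"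
    using z by (simp add: csqrt_exp_Ln diff_divide_distrib)
  also have "\<dots> = of_real (exp (ln (pi / 4) / 2)) * (z / 2) powr (- (1 / 2))"
    using z unfolding exp_add exp_of_real by (simp add: powr_def)
  also have "exp (ln (pi / 4) / 2) = sqrt (pi / 4)"
    by (simp flip: powr_half_sqrt add: powr_def)
  also have "\<dots> = sqrt pi / 2" by (simp add: real_sqrt_divide)
  finally have e: "csqrt (of_real pi / (2 * z)) = of_real (sqrt pi / 2) * (z / 2) powr (- (1 / 2))" .
  show ?thesis unfolding bessel_K_half_aux[OF z] e by simp
qed

theorem bessel_K_zeros_half:
  "bessel_K_zeros (of_nat n + 1 / 2) = {w. poly (H_poly n) w = 0}"
proof (rule set_eqI)
  fix w
  show "w \<in> bessel_K_zeros (of_nat n + 1 / 2) \<longleftrightarrow> w \<in> {w. poly (H_poly n) w = 0}"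
    using poly_H_poly_0[of n] by (cases "w = 0") (auto simp: bessel_K_zeros_def bessel_K_half_aux)
qed

corollary card_bessel_K_zeros_half: "card (bessel_K_zeros (of_nat n + 1 / 2)) = n"
  unfolding bessel_K_zeros_half by (rule card_H_poly_roots)

end

theory Submission
  imports Defs "HOL-Library.Z2" "HOL-Computational_Algebra.Polynomial_Factorial"
begin

text \<open>The differential equation \<open>x H'' = 2 (n + x) H' - 2 n H\<close> gives \<open>H''/H'\<close> at a zero, hence the first
  sum; the other two follow by partial fractions. With \<open>1/0 = 0\<close>, this is only sound if no two
  zeros have the same fourth power. That is shown modulo 2: the recurrence makes \<open>H\<close> separable over
  the field with two elements, while replacing all zeros by their squares does not change an integer
  polynomial modulo 2. So the monic integer polynomial whose roots are the fourth powers of the zeros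
  is separable modulo 2, and therefore has no multiple root.\<close>

section \<open>Reduction of integer polynomials\<close>

text \<open>The target ring stays open: the same map embeds integer polynomials into complex ones
  and reduces them modulo 2.\<close>

abbreviation of_int_poly :: "int poly \<Rightarrow> 'a :: comm_ring_1 poly" where
  "of_int_poly \<equiv> map_poly of_int"

lemma of_int_poly_add: "of_int_poly (p + q) = of_int_poly p + of_int_poly q"
  by (rule poly_eqI) (simp add: coeff_map_poly)

lemma of_int_poly_diff: "of_int_poly (p - q) = of_int_poly p - of_int_poly q"
  by (rule poly_eqI) (simp add: coeff_map_poly)

lemma of_int_poly_smult: "of_int_poly (smult c p) = smult (of_int c) (of_int_poly p)"
  by (rule poly_eqI) (simp add: coeff_map_poly)

lemma of_int_poly_mult: "of_int_poly (p * q) = of_int_poly p * of_int_poly q"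
  by (rule poly_eqI) (simp add: coeff_map_poly coeff_mult)

lemma of_int_poly_power: "of_int_poly (p ^ n) = of_int_poly p ^ n"
  by (induction n) (simp_all add: of_int_poly_mult)

lemma of_int_poly_pCons: "of_int_poly (pCons c p) = pCons (of_int c) (of_int_poly p)"
  by (simp add: map_poly_pCons)

lemma of_int_poly_pderiv:
  "of_int_poly (pderiv p) = (pderiv (of_int_poly p) :: 'a :: idom poly)"
  by (rule poly_eqI) (simp add: coeff_map_poly coeff_pderiv)

lemma of_int_poly_pcompose:
  "of_int_poly (pcompose p q) = pcompose (of_int_poly p) (of_int_poly q)"
  by (induction p)
    (simp_all add: pcompose_pCons of_int_poly_add of_int_poly_mult of_int_poly_pCons)

text \<open>Pseudo-division leaves a remainder that vanishes at \<open>c\<close>; by minimality of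
  the degree it is zero. Gauss's lemma then removes the multiplier that pseudo-division
  introduces.\<close>

lemma minimal_degree_int_poly_dvd:
  fixes c :: complex
  assumes g: "g \<noteq> 0" "content g = 1" "poly (of_int_poly g) c = 0"
    and min: "\<And>f. f \<noteq> 0 \<Longrightarrow> poly (of_int_poly f) c = 0 \<Longrightarrow> degree g \<le> degree f"
    and f: "poly (of_int_poly f) c = 0"
  shows "g dvd f"
proof -
  obtain a q where aq: "a \<noteq> 0" "smult a f = g * q + pseudo_mod f g"
    and deg: "pseudo_mod f g = 0 \<or> degree (pseudo_mod f g) < degree g"
    using pseudo_mod[OF g(1), of f] by auto
  have "poly (of_int_poly (smult a f)) c = poly (of_int_poly (g * q + pseudo_mod f g)) c"
    using aq(2) by simp
  hence "poly (of_int_poly (pseudo_mod f g)) c = 0"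
    using g(3) f by (simp add: of_int_poly_add of_int_poly_mult of_int_poly_smult)
  hence "pseudo_mod f g = 0"
    using min[of "pseudo_mod f g"] deg by linarith
  hence "smult a f = g * q" using aq(2) by simp
  \<comment> \<open>Contents are multiplicative and \<open>g\<close> is primitive, so
    \<open>a\<close> divides every coefficient of \<open>q\<close> and can be cancelled.\<close>
  moreover from this have "content q = \<bar>a\<bar> * content f"
    using g(2) by (metis content_mult content_smult lambda_one normalize_int_def)
  hence "[:a:] dvd q" by (simp add: const_poly_dvd_iff_dvd_content)
  then obtain r where "q = [:a:] * r" by (rule dvdE)
  ultimately have "smult a f = smult a (g * r)" by simp
  hence "smult a (f - g * r) = 0" by (simp add: smult_diff_right)
  thus ?thesis using aq(1) by simp
qed

text \<open>An integer polynomial \<open>g\<close> of least degree vanishing at \<open>c\<close> has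
  \<open>c\<close> as a simple root, because its derivative has smaller degree. Hence a double root
  of \<open>p\<close> is also a root of the cofactor, which \<open>g\<close> divides once
  more.\<close>

lemma int_poly_double_root_imp_square_factor:
  fixes c :: complex
  assumes p: "p \<noteq> 0" "poly (of_int_poly p) c = 0" "poly (pderiv (of_int_poly p)) c = 0"
  obtains g where "degree g > 0" "g ^ 2 dvd p"
proof -
  define P where "P = (\<lambda>f :: int poly. f \<noteq> 0 \<and> poly (of_int_poly f) c = 0)"
  have "P p" using p by (simp add: P_def)
  then obtain g0 where g0: "P g0" "\<And>f. P f \<Longrightarrow> degree g0 \<le> degree f"
    using exists_least_iff[of "\<lambda>d. \<exists>f. P f \<and> degree f = d"] by (metis not_le)
  \<comment> \<open>Passing to the primitive part preserves the degree and the root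
    \<open>c\<close>, and supplies the content 1 used for divisibility over the integers.\<close>
  define g where "g = primitive_part g0"
  have "g0 = smult (content g0) g" by (simp add: g_def)
  hence "of_int_poly g0 = smult (of_int (content g0)) (of_int_poly g :: complex poly)"
    by (metis of_int_poly_smult)
  hence root: "poly (of_int_poly g) c = 0"
    using g0(1) by (auto simp: P_def)
  have nz: "g \<noteq> 0" and cg: "content g = 1"
    using g0(1) by (simp_all add: g_def P_def)
  have min: "degree g \<le> degree f" if "f \<noteq> 0" "poly (of_int_poly f) c = 0" for f
    using g0(2)[of f] that by (simp add: g_def P_def)
  have dvd: "g dvd f" if "poly (of_int_poly f) c = 0" for f
    by (rule minimal_degree_int_poly_dvd[OF nz cg root _ that]) (rule min)
  have deg: "degree g > 0"
  proof (rule ccontr)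
    assume "\<not> degree g > 0"
    then obtain a where "g = [:a:]" by (auto elim: degree_eq_zeroE)
    thus False using root nz by (simp add: of_int_poly_pCons)
  qed
  obtain q where q: "p = g * q" using dvd[OF p(2)] by (auto elim: dvdE)
  have "poly (of_int_poly (pderiv g)) c \<noteq> 0"
  proof
    assume "poly (of_int_poly (pderiv g)) c = 0"
    moreover have "pderiv g \<noteq> 0" using deg by (simp add: pderiv_eq_0_iff)
    ultimately show False using min[of "pderiv g"] deg by (simp add: degree_pderiv)
  qed
  hence "poly (of_int_poly q) c = 0"
    using p(3) root by (simp add: q of_int_poly_mult pderiv_mult of_int_poly_pderiv)
  hence "g dvd q" by (rule dvd)
  hence "g ^ 2 dvd p" by (simp add: q power2_eq_square mult_dvd_mono)
  with deg show ?thesis by (rule that)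
qed

text \<open>A Bezout identity in place of a gcd: it makes sense in every commutative ring, and its
  closure rules are plain algebra.\<close>

definition comaximal :: "'a :: comm_ring_1 \<Rightarrow> 'a \<Rightarrow> bool" where
  "comaximal p q \<longleftrightarrow> (\<exists>a b. a * p + b * q = 1)"

lemma comaximal_commute: "comaximal p q \<longleftrightarrow> comaximal q p"
  unfolding comaximal_def by (metis add.commute)

lemma comaximal_mult_right:
  assumes "comaximal p q" "comaximal p r"
  shows "comaximal p (q * r)"
proof -
  obtain a b c d where "a * p + b * q = 1" "c * p + d * r = 1"
    using assms unfolding comaximal_def by blast
  hence "1 = (a * p + b * q) * (c * p + d * r)" by simp
  also have "\<dots> = (a * c * p + a * d * r + b * q * c) * p + (b * d) * (q * r)"
    by (simp add: algebra_simps)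
  finally show ?thesis unfolding comaximal_def by metis
qed

text \<open>One Euclidean step, which lets comaximality climb the recurrence of the Bessel
  polynomials.\<close>

lemma comaximal_add_mult_right:
  assumes "comaximal p q"
  shows "comaximal p (q + r * p)"
proof -
  obtain a b where "a * p + b * q = 1" using assms unfolding comaximal_def by blast
  hence "(a - b * r) * p + b * (q + r * p) = 1" by (simp add: algebra_simps)
  thus ?thesis unfolding comaximal_def by blast
qed

lemma comaximal_uminus_right: "comaximal p q \<Longrightarrow> comaximal p (- q)"
  unfolding comaximal_def by (metis minus_mult_minus)

lemma comaximal_common_dvd:
  assumes "comaximal p q" "g dvd p" "g dvd q"
  shows "g dvd 1"
  using assms unfolding comaximal_def by (metis dvd_add dvd_mult)

text \<open>A multiple root would make the square of a nonconstant integer polynomial divide \<open>p\<close>; its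
  leading coefficient is \<open>\<plusminus>1\<close>, so it stays nonconstant modulo 2.\<close>

lemma monic_int_poly_no_double_root:
  fixes c :: complex
  assumes monic: "lead_coeff p = 1"
    and sep: "comaximal (of_int_poly p) (pderiv (of_int_poly p) :: bit poly)"
  shows "\<not> (poly (of_int_poly p) c = 0 \<and> poly (pderiv (of_int_poly p)) c = 0)"
proof
  assume "poly (of_int_poly p) c = 0 \<and> poly (pderiv (of_int_poly p)) c = 0"
  moreover have "p \<noteq> 0" using monic by auto
  ultimately obtain g where g: "degree g > 0" "g ^ 2 dvd p"
    using int_poly_double_root_imp_square_factor by metis
  then obtain e where e: "p = g ^ 2 * e" by (auto elim: dvdE)
  have "lead_coeff g dvd 1"
    using monic by (metis e dvd_mult2 dvd_triv_left lead_coeff_mult power2_eq_square)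
  hence "lead_coeff g = 1 \<or> lead_coeff g = - 1"
    by auto
  hence "degree (of_int_poly g :: bit poly) = degree g"
    by (intro map_poly_degree_eq) auto
  moreover have "of_int_poly p = of_int_poly g * (of_int_poly g * of_int_poly e :: bit poly)"
    by (simp add: e of_int_poly_mult of_int_poly_power power2_eq_square mult_ac)
  hence "of_int_poly g dvd (of_int_poly p :: bit poly)"
    "of_int_poly g dvd (pderiv (of_int_poly p) :: bit poly)"
    by (simp_all add: pderiv_mult)
  hence "of_int_poly g dvd (1 :: bit poly)" using sep comaximal_common_dvd by blast
  ultimately show False
    using g(1) dvd_imp_degree_le[of "of_int_poly g" "1 :: bit poly"] by simp
qed

section \<open>Squaring the roots\<close>

text \<open>\<open>E\<close> and \<open>D\<close> collect the coefficients of even and odd index.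
  Prepending a coefficient exchanges their roles.\<close>

lemma poly_even_odd_decomp:
  fixes p :: "'a :: comm_ring_1 poly"
  obtains E D where "p = pcompose E [:0, 0, 1:] + [:0, 1:] * pcompose D [:0, 0, 1:]"
proof (induction p arbitrary: thesis)
  case 0
  show ?case by (rule 0[of 0 0]) simp
next
  case (pCons a p)
  obtain E D where ED: "p = pcompose E [:0, 0, 1:] + [:0, 1:] * pcompose D [:0, 0, 1:]"
    using pCons.IH by blast
  show ?case
    by (rule pCons.prems[of "pCons a D" E])
      (subst ED, simp add: pcompose_pCons algebra_simps)
qed

lemma bit_poly_2_eq_0: "(2 :: bit poly) = 0"
  by (simp add: numeral_poly)

text \<open>The cross term of the square carries a factor 2, and each of the two field elements
  equals its own square.\<close>

lemma bit_poly_square: "(p :: bit poly) ^ 2 = pcompose p [:0, 0, 1:]"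
proof (induction p)
  case (pCons a p)
  have "pCons a p = [:a:] + [:0, 1:] * p" by simp
  hence "pCons a p ^ 2 = [:a:] ^ 2 + [:0, 1:] ^ 2 * p ^ 2 + 2 * ([:a:] * ([:0, 1:] * p))"
    by (simp only: power2_sum power_mult_distrib mult.assoc)
  also have "\<dots> = [:a:] ^ 2 + [:0, 1:] ^ 2 * p ^ 2" unfolding bit_poly_2_eq_0 by simp
  also have "\<dots> = pcompose (pCons a p) [:0, 0, 1:]"
    by (cases a) (simp_all add: pcompose_pCons pCons.IH[symmetric] power2_eq_square)
  finally show ?case .
qed simp

text \<open>Graeffe's root-squaring step does not change an integer polynomial modulo 2, because squaring
  is the Frobenius endomorphism there.\<close>

lemma graeffe_mod_2:
  fixes z :: "'b \<Rightarrow> complex"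
  assumes A: "finite A" and p: "of_int_poly p = (\<Prod>k\<in>A. [:- z k, 1:])"
  obtains q where "of_int_poly q = (\<Prod>k\<in>A. [:- (z k ^ 2), 1:])"
    "of_int_poly q = (of_int_poly p :: bit poly)"
proof -
  obtain E D where ED: "p = pcompose E [:0, 0, 1:] + [:0, 1:] * pcompose D [:0, 0, 1:]"
    by (rule poly_even_odd_decomp)
  \<comment> \<open>At \<open>y = x^2\<close> the product \<open>p(x) * p(-x)\<close> equals
    \<open>E(y)^2 - y * D(y)^2\<close>. The sign turns the factors of \<open>p(-x)\<close> into
    monic ones.\<close>
  define q where "q = smult ((- 1) ^ card A) (E ^ 2 - [:0, 1:] * D ^ 2)"
  have "poly (of_int_poly q) y = poly (\<Prod>k\<in>A. [:- (z k ^ 2), 1:]) y" for y :: complex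
  proof -
    \<comment> \<open>Every complex \<open>y\<close> is a square, so the two polynomials can be
      compared at all points through \<open>p(x) * p(-x)\<close>.\<close>
    define x where "x = csqrt y"
    have y: "y = x ^ 2" by (simp add: x_def)
    have val: "poly (of_int_poly p) w = poly (of_int_poly E) (w ^ 2) + w * poly (of_int_poly D) (w ^ 2)"
      for w :: complex
      by (subst ED) (simp add: of_int_poly_add of_int_poly_mult of_int_poly_pcompose
          of_int_poly_pCons poly_pcompose power2_eq_square)
    have "poly (of_int_poly q) y = (- 1) ^ card A * (poly (of_int_poly p) x * poly (of_int_poly p) (- x))"
      unfolding val by (simp add: q_def y of_int_poly_smult of_int_poly_diff of_int_poly_mult
          of_int_poly_power of_int_poly_pCons) (simp add: algebra_simps power2_eq_square)
    also have "\<dots> = (\<Prod>k\<in>A. - 1) * ((\<Prod>k\<in>A. x - z k) * (\<Prod>k\<in>A. - z k - x))"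
      by (simp add: p poly_prod)
    also have "\<dots> = (\<Prod>k\<in>A. - 1 * ((x - z k) * (- z k - x)))"
      by (simp only: prod.distrib)
    also have "\<dots> = (\<Prod>k\<in>A. y - z k ^ 2)"
      by (intro prod.cong refl) (simp add: y power2_eq_square algebra_simps)
    finally show ?thesis by (simp add: poly_prod)
  qed
  hence "of_int_poly q = (\<Prod>k\<in>A. [:- (z k ^ 2), 1:])"
    by (simp add: poly_eq_poly_eq_iff[symmetric] fun_eq_iff)
  \<comment> \<open>Signs disappear modulo 2, and Frobenius turns \<open>E^2 + X * D^2\<close> back
    into \<open>E(X^2) + X * D(X^2)\<close>.\<close>
  moreover have "of_int_poly q = (of_int_poly p :: bit poly)"
    by (subst ED) (simp add: q_def of_int_poly_smult of_int_poly_diff of_int_poly_add of_int_poly_mult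
        of_int_poly_power of_int_poly_pcompose of_int_poly_pCons bit_poly_2_eq_0 flip: bit_poly_square)
  ultimately show ?thesis by (rule that)
qed

section \<open>The Bessel polynomials modulo 2\<close>

text \<open>The reverse Bessel polynomials. The recurrence has integer coefficients and therefore
  defines the family over the integers, the complex numbers and the field with two elements
  alike.\<close>

fun bessel_poly :: "nat \<Rightarrow> 'a :: comm_ring_1 poly" where
  "bessel_poly 0 = 1"
| "bessel_poly (Suc 0) = [:1, 1:]"
| "bessel_poly (Suc (Suc n)) =
     smult (of_nat (2 * n + 3)) (bessel_poly (Suc n)) + [:0, 0, 1:] * bessel_poly n"

lemma H_poly_eq_bessel_poly: "H_poly n = bessel_poly n"
proof (induction n rule: bessel_poly.induct)
  case 1
  show ?case by (rule poly_eqI) (simp add: coeff_H_poly coeff_1)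
next
  case 2
  show ?case
    by (rule poly_eqI) (auto simp: coeff_H_poly coeff_pCons split: nat.splits)
next
  case (3 n)
  have "monom 1 2 = ([:0, 0, 1:] :: complex poly)"
    by (simp add: monom_altdef power2_eq_square)
  thus ?case by (simp add: H_poly_rec 3)
qed

lemma of_int_poly_bessel_poly: "of_int_poly (bessel_poly n) = bessel_poly n"
  by (induction n rule: bessel_poly.induct)
    (simp_all add: of_int_poly_add of_int_poly_mult of_int_poly_smult of_int_poly_pCons)

text \<open>Induction along the recurrence gives the identity over every integral domain, also
  modulo 2, where quotients of factorials are meaningless.\<close>

lemma pderiv_bessel_poly:
  "pderiv (bessel_poly (Suc n)) = bessel_poly (Suc n) - [:0, 1:] * (bessel_poly n :: 'a :: idom poly)"
proof (induction n rule: bessel_poly.induct)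
  case 1
  show ?case by (simp add: pderiv_pCons one_pCons)
next
  case 2
  show ?case by (simp add: pderiv_pCons pderiv_add pderiv_mult pderiv_smult one_pCons)
next
  case (3 n)
  define b where "b = (bessel_poly n :: 'a poly)"
  define c where "c = (bessel_poly (Suc n) :: 'a poly)"
  define d where "d = (bessel_poly (Suc (Suc n)) :: 'a poly)"
  define X where "X = ([:0, 1:] :: 'a poly)"
  have X: "[:0, 0, 1:] = X * X" "pderiv X = 1"
    by (simp_all add: X_def pderiv_pCons one_pCons)
  have s: "smult (of_nat m) p = of_nat m * p" for m and p :: "'a poly"
    by (simp add: of_nat_poly)
  have d: "d = of_nat (2 * n + 3) * c + X * X * b"
    by (simp only: d_def c_def b_def bessel_poly.simps s X)
  have e: "bessel_poly (Suc (Suc (Suc n))) = of_nat (2 * Suc n + 3) * d + X * X * c"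
    unfolding d_def c_def by (simp only: bessel_poly.simps(3)[of "Suc n"] s X)
  have "pderiv c = c - X * b" "pderiv d = d - X * c"
    using 3 by (simp_all only: d_def c_def b_def X_def)
  hence "pderiv (of_nat (2 * Suc n + 3) * d + X * X * c) =
      of_nat (2 * Suc n + 3) * (d - X * c) + 2 * X * c + X * X * (c - X * b)"
    by (simp only: pderiv_add pderiv_mult pderiv_of_nat X) (simp add: algebra_simps)
  \<comment> \<open>The multiples of \<open>X * c\<close> combine to the factor
    \<open>2 * n + 3\<close>, since \<open>(2 * n + 5) - 2 = 2 * n + 3\<close>; this is the
    coefficient of \<open>c\<close> in the recurrence for \<open>d\<close>.\<close>
  also have "\<dots> = of_nat (2 * Suc n + 3) * d + X * X * c - X * d"
    by (subst (3) d) (simp add: algebra_simps)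
  finally show ?case unfolding e X_def[symmetric] d_def[symmetric] .
qed

text \<open>The recurrence multiplies the constant term by odd numbers only, so it is 1 modulo
  2.\<close>

lemma comaximal_bessel_poly_X: "comaximal (bessel_poly n) ([:0, 1:] :: bit poly)"
proof -
  have c0: "coeff (bessel_poly n :: bit poly) 0 = 1"
    by (induction n rule: bessel_poly.induct) simp_all
  obtain q where "(bessel_poly n :: bit poly) = pCons 1 q"
    using c0 by (cases "bessel_poly n :: bit poly" rule: pCons_cases) simp
  hence "1 * (bessel_poly n :: bit poly) + (- q) * [:0, 1:] = 1"
    by (simp add: one_pCons)
  thus ?thesis unfolding comaximal_def by blast
qed

text \<open>Modulo \<open>bessel_poly (Suc n)\<close>, the next polynomial is
  \<open>X^2 * bessel_poly n\<close>, and both \<open>X\<close> and \<open>bessel_poly n\<close> are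
  comaximal with the modulus.\<close>

lemma comaximal_bessel_poly_Suc: "comaximal (bessel_poly (Suc n)) (bessel_poly n :: bit poly)"
proof (induction n)
  case 0
  show ?case unfolding comaximal_def by (rule exI[of _ 0], rule exI[of _ 1]) simp
next
  case (Suc n)
  have "[:0, 0, 1:] * bessel_poly n = [:0, 1:] * ([:0, 1:] * (bessel_poly n :: bit poly))"
    by simp
  hence "comaximal (bessel_poly (Suc n)) ([:0, 0, 1:] * bessel_poly n :: bit poly)"
    using Suc comaximal_bessel_poly_X by (metis comaximal_mult_right)
  from comaximal_add_mult_right[OF this, of "[:of_nat (2 * n + 3):]"]
  show ?case by (subst comaximal_commute) (simp add: add.commute)
qed

text \<open>Modulo the polynomial itself, the derivative is \<open>-X\<close> times its
  predecessor.\<close>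

lemma comaximal_bessel_poly_pderiv: "comaximal (bessel_poly n) (pderiv (bessel_poly n) :: bit poly)"
proof (cases n)
  case 0
  show ?thesis unfolding comaximal_def by (rule exI[of _ 1], rule exI[of _ 0]) (simp add: 0)
next
  case (Suc m)
  have "comaximal (bessel_poly (Suc m)) ([:0, 1:] * bessel_poly m :: bit poly)"
    using comaximal_bessel_poly_X comaximal_bessel_poly_Suc by (rule comaximal_mult_right)
  from comaximal_add_mult_right[OF comaximal_uminus_right[OF this], of 1]
  show ?thesis unfolding Suc pderiv_bessel_poly mult_1 uminus_add_conv_diff .
qed

text \<open>Two root-squaring steps give a monic integer polynomial congruent to the Bessel
  polynomial modulo 2. Equal fourth powers at different indices would be a double root of
  it.\<close>

lemma H_poly_roots_power4_inj:
  fixes z :: "'b \<Rightarrow> complex"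
  assumes A: "finite A" and H: "H_poly n = (\<Prod>k\<in>A. [:- z k, 1:])"
  shows "inj_on (\<lambda>k. z k ^ 4) A"
proof (rule inj_onI, rule ccontr)
  fix j k assume jk: "j \<in> A" "k \<in> A" "z j ^ 4 = z k ^ 4" "j \<noteq> k"
  have h: "of_int_poly (bessel_poly n) = (\<Prod>k\<in>A. [:- z k, 1:])"
    using H by (simp add: of_int_poly_bessel_poly H_poly_eq_bessel_poly)
  obtain r where r: "of_int_poly r = (\<Prod>k\<in>A. [:- (z k ^ 2), 1:])"
    "of_int_poly r = (of_int_poly (bessel_poly n) :: bit poly)"
    using graeffe_mod_2[OF A h] .
  obtain q where q: "of_int_poly q = (\<Prod>k\<in>A. [:- ((z k ^ 2) ^ 2), 1:])"
    "of_int_poly q = (of_int_poly r :: bit poly)"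
    using graeffe_mod_2[OF A r(1)] .
  have "of_int (lead_coeff q) = lead_coeff (of_int_poly q :: complex poly)"
    by (subst degree_map_poly) (auto simp: coeff_map_poly)
  also have "\<dots> = 1" unfolding q by (simp add: lead_coeff_prod)
  finally have monic: "lead_coeff q = 1" by simp
  have sep: "comaximal (of_int_poly q) (pderiv (of_int_poly q) :: bit poly)"
    unfolding q(2) r(2) of_int_poly_bessel_poly by (rule comaximal_bessel_poly_pderiv)
  define u where "u = [:- (z j ^ 4), 1:]"
  define v where "v = (\<Prod>k\<in>A - {j} - {k}. [:- (z k ^ 4), 1:])"
  have "of_int_poly q = (\<Prod>k\<in>A. [:- (z k ^ 4), 1:])"
    unfolding q(1) by (simp flip: power_mult)
  also have "\<dots> = u * (u * v)"
    unfolding u_def v_def using A jk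
    by (subst prod.remove[of A j], simp, simp, subst prod.remove[of "A - {j}" k]) auto
  finally have quv: "of_int_poly q = u * (u * v)" .
  have "poly u (z j ^ 4) = 0" by (simp add: u_def)
  thus False
    using monic_int_poly_no_double_root[OF monic sep, of "z j ^ 4"]
    by (simp add: quv pderiv_mult)
qed

section \<open>Sums over the zeros\<close>

text \<open>This is the modified Bessel equation after removal of the elementary factor of
  \<open>bessel_K\<close>. On coefficients it is a relation between two consecutive ones.\<close>

lemma H_poly_ode:
  "[:0, 1:] * pderiv (pderiv (H_poly n)) =
     [:2 * of_nat n, 2:] * pderiv (H_poly n) - smult (2 * of_nat n) (H_poly n)"
proof (rule poly_eqI)
  fix k
  define h where "h = coeff (H_poly n)"
  have rec: "of_nat (Suc k) * (2 * of_nat n - of_nat k) * h (Suc k) = 2 * (of_nat n - of_nat k) * h k"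
  proof (cases "k < n")
    case True
    define a where "a = n - Suc k"
    have e: "2 * n - k = Suc (2 * n - Suc k)" "n - k = Suc a" using True by (auto simp: a_def)
    moreover have "2 * of_nat n - of_nat k = (of_nat (Suc (2 * n - Suc k)) :: complex)"
      "of_nat n - of_nat k = (of_nat (Suc a) :: complex)"
      unfolding e[symmetric] using True by (simp_all add: of_nat_diff)
    ultimately show ?thesis using True unfolding h_def coeff_H_poly a_def[symmetric]
      by (simp add: divide_simps del: of_nat_Suc)
  qed (auto simp: h_def coeff_H_poly)
  show "coeff ([:0, 1:] * pderiv (pderiv (H_poly n))) k =
    coeff ([:2 * of_nat n, 2:] * pderiv (H_poly n) - smult (2 * of_nat n) (H_poly n)) k"
    using rec by (cases k)
      (auto simp: coeff_pderiv coeff_pCons h_def[symmetric] algebra_simps)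
qed

text \<open>With \<open>p = (X - z j) * q\<close>, the first two derivatives of \<open>p\<close> at
  \<open>z j\<close> are \<open>q (z j)\<close> and \<open>2 * q' (z j)\<close>. The sum is minus
  the logarithmic derivative of \<open>q\<close> there.\<close>

lemma sum_inverse_root_differences:
  fixes z :: "'b \<Rightarrow> complex"
  assumes A: "finite A" "j \<in> A" "inj_on z A"
    and p: "p = (\<Prod>k\<in>A. [:- z k, 1:])"
  shows "poly (pderiv p) (z j) \<noteq> 0"
    and "poly (pderiv (pderiv p)) (z j) =
      - 2 * (\<Sum>k\<in>A - {j}. 1 / (z k - z j)) * poly (pderiv p) (z j)"
proof -
  define B where "B = A - {j}"
  define q where "q = (\<Prod>k\<in>B. [:- z k, 1:])"
  have B: "finite B" using A by (simp add: B_def)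
  have ne: "z j \<noteq> z k" if "k \<in> B" for k
    using that A by (auto simp: B_def dest: inj_onD)
  have pq: "p = [:- z j, 1:] * q"
    using A by (simp add: p q_def B_def prod.remove[of A j])
  have d1: "poly (pderiv p) (z j) = poly q (z j)"
    and d2: "poly (pderiv (pderiv p)) (z j) = 2 * poly (pderiv q) (z j)"
  proof -
    have "pderiv p = q + [:- z j, 1:] * pderiv q"
      unfolding pq pderiv_mult by (simp add: pderiv_pCons)
    moreover from this have "pderiv (pderiv p) = 2 * pderiv q + [:- z j, 1:] * pderiv (pderiv q)"
      by (simp only: pderiv_add pderiv_mult) (simp add: pderiv_pCons)
    ultimately show "poly (pderiv p) (z j) = poly q (z j)"
      "poly (pderiv (pderiv p)) (z j) = 2 * poly (pderiv q) (z j)" by simp_all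
  qed
  have q0: "poly q (z j) \<noteq> 0"
    using B ne by (simp add: q_def poly_prod)
  thus "poly (pderiv p) (z j) \<noteq> 0" by (simp add: d1)
  have "poly (pderiv q) (z j) = (\<Sum>k\<in>B. poly (\<Prod>i\<in>B - {k}. [:- z i, 1:]) (z j))"
    by (simp add: q_def pderiv_prod poly_sum pderiv_pCons)
  also have "\<dots> = (\<Sum>k\<in>B. - (1 / (z k - z j)) * poly q (z j))"
  proof (rule sum.cong[OF refl])
    fix k assume k: "k \<in> B"
    have "q = [:- z k, 1:] * (\<Prod>i\<in>B - {k}. [:- z i, 1:])"
      using B k by (simp add: q_def prod.remove[of B k])
    hence "poly q (z j) = (z j - z k) * poly (\<Prod>i\<in>B - {k}. [:- z i, 1:]) (z j)"
      by (simp add: left_diff_distrib)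
    thus "poly (\<Prod>i\<in>B - {k}. [:- z i, 1:]) (z j) = - (1 / (z k - z j)) * poly q (z j)"
      using ne[OF k] by (simp add: field_simps)
  qed
  also have "\<dots> = - (\<Sum>k\<in>B. 1 / (z k - z j)) * poly q (z j)"
    by (simp only: sum_distrib_right[symmetric] sum_negf)
  finally show "poly (pderiv (pderiv p)) (z j) =
      - 2 * (\<Sum>k\<in>A - {j}. 1 / (z k - z j)) * poly (pderiv p) (z j)"
    by (simp add: d1 d2 B_def)
qed

theorem theorem3:
  fixes n :: nat and \<nu> :: complex and z :: "nat \<Rightarrow> complex"
  assumes nu: "\<nu> = of_nat n + 1 / 2"
    and zeros: "bij_betw z {1..n} (bessel_K_zeros \<nu>)"
  shows "\<forall>j\<in>{1..n}.
     (\<Sum>k\<in>{1..n} - {j}. 1 / (z k - z j)) = (1 - 2 * z j - 2 * \<nu>) / (2 * z j) \<and>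
     (\<Sum>k\<in>{1..n} - {j}. 1 / (z k ^ 2 - z j ^ 2)) =
        (1 - z j - \<nu>) / (2 * z j ^ 2) - 1 / (2 * z j) * (\<Sum>k=1..n. 1 / (z k + z j)) \<and>
     (\<Sum>k\<in>{1..n} - {j}. 1 / (z k ^ 4 - z j ^ 4)) =
        (2 - \<nu> - z j) / (4 * z j ^ 4) -
        1 / (4 * z j ^ 3) *
          (\<Sum>k=1..n. (1 / (z j + z k) + 2 * z j / (z j ^ 2 + z k ^ 2)))"
proof
  fix j assume j: "j \<in> {1..n}"
  have fin: "finite {1..n}" and inj: "inj_on z {1..n}"
    using zeros by (simp_all add: bij_betw_def)
  have img: "z ` {1..n} = {w. poly (H_poly n) w = 0}"
    using zeros by (simp add: bij_betw_def nu bessel_K_zeros_half)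
  have "H_poly n = (\<Prod>w | poly (H_poly n) w = 0. [:- w, 1:])"
    using complex_poly_decompose_rsquarefree[OF rsquarefree_H_poly[of n]]
    by (simp add: degree_H_poly(2))
  hence H: "H_poly n = (\<Prod>k\<in>{1..n}. [:- z k, 1:])"
    unfolding img[symmetric] prod.reindex[OF inj] by simp
  have root: "poly (H_poly n) (z j) = 0" using img j by blast
  define b where "b = z j"
  have b0: "b \<noteq> 0" using root poly_H_poly_0[of n] by (auto simp: b_def)
  have ne4: "z k ^ 4 \<noteq> b ^ 4" if "k \<in> {1..n} - {j}" for k
    using H_poly_roots_power4_inj[OF fin H] that j by (auto simp: b_def dest: inj_onD)
  have pow4: "x ^ 4 - b ^ 4 = (x - b) * ((x + b) * (x ^ 2 + b ^ 2))" for x :: complex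
    by (simp add: algebra_simps power2_eq_square power4_eq_xxxx)
  \<comment> \<open>The factors of \<open>z k ^ 4 - b ^ 4\<close> are exactly the denominators of
    the partial fractions, so none of them falls under the convention for division by zero.\<close>
  have ne: "z k - b \<noteq> 0" "z k + b \<noteq> 0" "z k ^ 2 + b ^ 2 \<noteq> 0" if "k \<in> {1..n} - {j}" for k
    using ne4[OF that] pow4[of "z k"] by auto
  define S where "S = (\<Sum>k\<in>{1..n} - {j}. 1 / (z k - b))"
  define T where "T = (\<Sum>k\<in>{1..n} - {j}. 1 / (z k + b))"
  define U where "U = (\<Sum>k\<in>{1..n} - {j}. 2 * b / (b ^ 2 + z k ^ 2))"
  note sums = sum_inverse_root_differences[OF fin j inj H]
  \<comment> \<open>The differential equation at the zero \<open>b\<close>, where the term with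
    \<open>H_poly n\<close> itself drops out.\<close>
  have "b * (- 2 * S * poly (pderiv (H_poly n)) b) = (2 * of_nat n + 2 * b) * poly (pderiv (H_poly n)) b"
    using arg_cong[OF H_poly_ode[of n], of "\<lambda>p. poly p b"] sums(2) root
    by (simp add: b_def S_def algebra_simps)
  hence "(2 * poly (pderiv (H_poly n)) b) * (b * S) = (2 * poly (pderiv (H_poly n)) b) * (- of_nat n - b)"
    by algebra
  hence "b * S = - of_nat n - b"
    using sums(1) by (simp add: b_def)
  hence S: "S = (- of_nat n - b) / b"
    using b0 by (simp add: field_simps)
  \<comment> \<open>The full sums include \<open>k = j\<close>. That term is
    \<open>1 / (2 * b)\<close> here, and it gains \<open>2 * b / (2 * b ^ 2) = 1 / b\<close> in the
    sum below.\<close>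
  have T: "(\<Sum>k=1..n. 1 / (z k + b)) = 1 / (2 * b) + T"
    using j by (simp add: sum.remove[of _ j] T_def b_def)
  have U: "(\<Sum>k=1..n. (1 / (b + z k) + 2 * b / (b ^ 2 + z k ^ 2))) = 1 / (2 * b) + T + (1 / b + U)"
    using j b0 by (simp add: sum.remove[of _ j] sum.distrib T_def U_def b_def add.commute power2_eq_square)
  have "(\<Sum>k\<in>{1..n} - {j}. 1 / (z k ^ 2 - b ^ 2)) =
      (\<Sum>k\<in>{1..n} - {j}. 1 / (2 * b) * (1 / (z k - b) - 1 / (z k + b)))"
  proof (rule sum.cong[OF refl])
    fix k assume "k \<in> {1..n} - {j}"
    have "z k ^ 2 - b ^ 2 = (z k - b) * (z k + b)" by (simp add: algebra_simps power2_eq_square)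
    thus "1 / (z k ^ 2 - b ^ 2) = 1 / (2 * b) * (1 / (z k - b) - 1 / (z k + b))"
      using ne[OF \<open>k \<in> _\<close>] b0 by (simp add: divide_simps)
  qed
  also have "\<dots> = 1 / (2 * b) * (S - T)"
    by (simp only: sum_distrib_left[symmetric] sum_subtractf S_def T_def)
  finally have E2: "(\<Sum>k\<in>{1..n} - {j}. 1 / (z k ^ 2 - b ^ 2)) = 1 / (2 * b) * (S - T)" .
  have "(\<Sum>k\<in>{1..n} - {j}. 1 / (z k ^ 4 - b ^ 4)) =
      (\<Sum>k\<in>{1..n} - {j}. 1 / (4 * b ^ 3) * (1 / (z k - b) - 1 / (z k + b) - 2 * b / (b ^ 2 + z k ^ 2)))"
  proof (rule sum.cong[OF refl])
    fix k assume "k \<in> {1..n} - {j}"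
    note nz = ne[OF this]
    have "1 / (z k - b) - 1 / (z k + b) = 2 * b / ((z k - b) * (z k + b))"
      using nz by (simp add: divide_simps)
    also have "\<dots> - 2 * b / (b ^ 2 + z k ^ 2) =
        2 * b * ((z k ^ 2 + b ^ 2) - (z k - b) * (z k + b)) / ((z k - b) * (z k + b) * (z k ^ 2 + b ^ 2))"
    proof -
      have "u / v - u / w = u * (w - v) / (v * w)" if "v \<noteq> 0" "w \<noteq> 0" for u v w :: complex
        using that by (simp add: field_simps)
      from this[of "(z k - b) * (z k + b)" "z k ^ 2 + b ^ 2" "2 * b"] nz show ?thesis
        by (simp only: add.commute[of "b ^ 2"] mult_eq_0_iff simp_thms)
    qed
    also have "2 * b * ((z k ^ 2 + b ^ 2) - (z k - b) * (z k + b)) = 4 * b ^ 3"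
      by (simp add: algebra_simps power2_eq_square power3_eq_cube)
    also have "(z k - b) * (z k + b) * (z k ^ 2 + b ^ 2) = z k ^ 4 - b ^ 4"
      by (simp add: pow4)
    finally have diff: "1 / (z k - b) - 1 / (z k + b) - 2 * b / (b ^ 2 + z k ^ 2) =
        4 * b ^ 3 / (z k ^ 4 - b ^ 4)" .
    show "1 / (z k ^ 4 - b ^ 4) =
        1 / (4 * b ^ 3) * (1 / (z k - b) - 1 / (z k + b) - 2 * b / (b ^ 2 + z k ^ 2))"
      unfolding diff using b0 by simp
  qed
  also have "\<dots> = 1 / (4 * b ^ 3) * (S - T - U)"
    by (simp only: sum_distrib_left[symmetric] sum_subtractf S_def T_def U_def)
  finally have E4: "(\<Sum>k\<in>{1..n} - {j}. 1 / (z k ^ 4 - b ^ 4)) = 1 / (4 * b ^ 3) * (S - T - U)" .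
  \<comment> \<open>Three forms of the same value under \<open>\<nu> = n + 1/2\<close>; the
    subtracted fractions in the last two are the terms with \<open>k = j\<close>.\<close>
  have S1: "S = (1 - 2 * b - 2 * \<nu>) / (2 * b)"
    and S2: "S = (1 - b - \<nu>) / b - 1 / (2 * b)"
    and S4: "S = (2 - \<nu> - b) / b - 1 / (2 * b) - 1 / b"
    using b0 by (simp_all add: S nu field_simps)
  have shift2: "s * (S - T) = r - s * (u + T)" if "r = s * (S + u)" for r s u
    using that by (simp add: algebra_simps)
  have shift4: "s * (S - T - U) = r - s * (u + T + (w + U))" if "r = s * (S + u + w)" for r s u w
    using that by (simp add: algebra_simps)
  have "(1 - b - \<nu>) / (2 * b ^ 2) = 1 / (2 * b) * ((1 - b - \<nu>) / b)"
    by (simp add: power2_eq_square)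
  also have "\<dots> = 1 / (2 * b) * (S + 1 / (2 * b))"
    by (subst S2) simp
  finally have I2: "1 / (2 * b) * (S - T) =
      (1 - b - \<nu>) / (2 * b ^ 2) - 1 / (2 * b) * (1 / (2 * b) + T)"
    by (rule shift2)
  have "b ^ 4 = b ^ 3 * b"
    by (simp only: power4_eq_xxxx power3_eq_cube)
  hence "(2 - \<nu> - b) / (4 * b ^ 4) = 1 / (4 * b ^ 3) * ((2 - \<nu> - b) / b)"
    by (simp only: times_divide_times_eq mult_1 mult.assoc)
  also have "\<dots> = 1 / (4 * b ^ 3) * (S + 1 / (2 * b) + 1 / b)"
    by (subst S4) simp
  finally have I4: "1 / (4 * b ^ 3) * (S - T - U) =
      (2 - \<nu> - b) / (4 * b ^ 4) - 1 / (4 * b ^ 3) * (1 / (2 * b) + T + (1 / b + U))"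
    by (rule shift4)
  show "(\<Sum>k\<in>{1..n} - {j}. 1 / (z k - z j)) = (1 - 2 * z j - 2 * \<nu>) / (2 * z j) \<and>
     (\<Sum>k\<in>{1..n} - {j}. 1 / (z k ^ 2 - z j ^ 2)) =
        (1 - z j - \<nu>) / (2 * z j ^ 2) - 1 / (2 * z j) * (\<Sum>k=1..n. 1 / (z k + z j)) \<and>
     (\<Sum>k\<in>{1..n} - {j}. 1 / (z k ^ 4 - z j ^ 4)) =
        (2 - \<nu> - z j) / (4 * z j ^ 4) -
        1 / (4 * z j ^ 3) *
          (\<Sum>k=1..n. (1 / (z j + z k) + 2 * z j / (z j ^ 2 + z k ^ 2)))"
    unfolding b_def[symmetric] S_def[symmetric] T U E2 E4 using S1 I2 I4 by (intro conjI)
qed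

end
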